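(* Let $v=(v_i)_{i\in N}$ with $v_i\in\mathbb{R}^d$ and $\bar v=(\bar v_i)_{i\in N}$ with $\bar v_i\in\mathbb{R}^{\bar d}$ be two normalized arrangements with matrices $M\in\mathbb{R}^{n\times d}$ and $\bar M\in\mathbb{R}^{n\times\bar d}$. Then $v$ and $\bar v$ are equivalent if and only if $d=\bar d$ and there is an orthogonal transformation $T\in \mathrm{O}(\mathbb{R}^d)$ with $\bar v_i=Tv_i$ for all $i\in N$. In this case the orthogonal transformation is given by $T=\bar M^{\top} M$.
   Context: Let $n\ge 1$ and $N=\{1,\dots,n\}$. A ($d$-dimensional) arrangement is a family of points $v_i\in\mathbb{R}^d$, $i\in N$ (with $d\ge 1$). Its matrix $M\in\mathbb{R}^{n\times d}$ is the matrix whose $i$-th row is $v_i^\top$, and its arrangement space is the column span $U=\mathrm{span}\,M\subseteq\mathbb{R}^n$. Two arrangements are equivalent if they have the same arrangement space. An arrangement is normalized if $M^\top M=\mathrm{Id}$. *)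

theory Defs
  imports Complex_Main "Jordan_Normal_Form.VS_Connect"
begin

text \<open>
  An arrangement is a family \<open>v :: nat \<Rightarrow> real vec\<close> of which only the values on the index set
  \<open>{1..n}\<close> matter. Since matrices in this library are indexed from 0, the vector \<open>v i\<close> is the row
  with index \<open>i - 1\<close> of \<open>arrangement_mat n d v\<close>.
\<close>

definition arrangement :: "nat \<Rightarrow> nat \<Rightarrow> (nat \<Rightarrow> real vec) \<Rightarrow> bool" where
  "arrangement n d v \<longleftrightarrow> 1 \<le> d \<and> (\<forall>i\<in>{1..n}. v i \<in> carrier_vec d)"

definition arrangement_mat :: "nat \<Rightarrow> nat \<Rightarrow> (nat \<Rightarrow> real vec) \<Rightarrow> real mat" where
  "arrangement_mat n d v = mat_of_rows d (map v [1..<Suc n])"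

definition arrangement_space :: "nat \<Rightarrow> nat \<Rightarrow> (nat \<Rightarrow> real vec) \<Rightarrow> real vec set" where
  "arrangement_space n d v = vec_space.col_space n (arrangement_mat n d v)"

definition equivalent_arrangements ::
  "nat \<Rightarrow> nat \<Rightarrow> (nat \<Rightarrow> real vec) \<Rightarrow> nat \<Rightarrow> (nat \<Rightarrow> real vec) \<Rightarrow> bool" where
  "equivalent_arrangements n d v d' w \<longleftrightarrow> arrangement_space n d v = arrangement_space n d' w"

definition normalized_arrangement :: "nat \<Rightarrow> nat \<Rightarrow> (nat \<Rightarrow> real vec) \<Rightarrow> bool" where
  "normalized_arrangement n d v \<longleftrightarrow> arrangement n d v \<and>
     transpose_mat (arrangement_mat n d v) * arrangement_mat n d v = 1\<^sub>m d"

text \<open>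
  The library's \<open>orthogonal_mat\<close> only asks for pairwise orthogonal, non-zero columns, so it does
  not describe the orthogonal group.
\<close>

definition orthogonal_group :: "nat \<Rightarrow> real mat set" where
  "orthogonal_group d = {T \<in> carrier_mat d d. transpose_mat T * T = 1\<^sub>m d}"

end

theory Submission
  imports Defs
begin

text \<open>
  Let \<open>A\<close> and \<open>B\<close> be the matrices of the two normalized arrangements. Since \<open>A\<^sup>T A = 1\<close>, the
  matrix \<open>A A\<^sup>T\<close> is the orthogonal projection onto the column space of \<open>A\<close>, and likewise for \<open>B\<close>.
  If the two column spaces agree, each projection fixes the columns of the other matrix:
  \<open>A A\<^sup>T B = B\<close> and \<open>B B\<^sup>T A = A\<close> (\<open>mult_mult_transpose_fixes\<close>). For \<open>T = B\<^sup>T A\<close> this gives at once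
  \<open>T\<^sup>T T = A\<^sup>T B B\<^sup>T A = 1\<close>, \<open>T T\<^sup>T = B\<^sup>T A A\<^sup>T B = 1\<close> and \<open>A T\<^sup>T = B\<close>. The first two identities
  force \<open>T\<close> to be square (\<open>dim_eq_if_two_sided_transpose_inverse\<close>), so the dimensions agree and \<open>T\<close>
  is orthogonal; the third says row by row that \<open>w\<^sub>i = T v\<^sub>i\<close> (\<open>rows_image_iff\<close>).

  Conversely \<open>B = A T\<^sup>T\<close> with \<open>T\<close> orthogonal also gives \<open>A = B T\<close>, so each column space contains
  the other. Multiplying \<open>B = A T\<^sup>T\<close> by \<open>A\<^sup>T\<close> from the left shows \<open>T\<^sup>T = A\<^sup>T B\<close>, hence the formula
  for \<open>T\<close> and its uniqueness.
\<close>

lemma col_space_eq_image: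
  fixes A :: "real mat"
  assumes "A \<in> carrier_mat n d"
  shows "vec_space.col_space n A = (\<lambda>x. A *\<^sub>v x) ` carrier_vec d"
proof -
  interpret vec_space "TYPE(real)" n .
  show ?thesis
    using assms by (auto simp: col_space_eq[OF assms])
qed

lemma col_space_mult_subset:
  fixes A :: "real mat"
  assumes A: "A \<in> carrier_mat n d" and C: "C \<in> carrier_mat d k"
  shows "vec_space.col_space n (A * C) \<subseteq> vec_space.col_space n A"
proof -
  have AC: "A * C \<in> carrier_mat n k"
    using A C by simp
  show ?thesis
    unfolding col_space_eq_image[OF AC] col_space_eq_image[OF A]
    using C by (auto simp: assoc_mult_mat_vec[OF A C])
qed

text \<open>
  A matrix \<open>A\<close> with orthonormal columns satisfies \<open>A A\<^sup>T (A x) = A x\<close>, that is, \<open>A A\<^sup>T\<close> acts as the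
  identity on the column space of \<open>A\<close>, in particular on the columns of \<open>B\<close>.
\<close>

lemma mult_mult_transpose_fixes:
  fixes A B :: "real mat"
  assumes A: "A \<in> carrier_mat n d" and B: "B \<in> carrier_mat n k"
    and orthonormal: "transpose_mat A * A = 1\<^sub>m d"
    and sub: "vec_space.col_space n B \<subseteq> vec_space.col_space n A"
  shows "A * (transpose_mat A * B) = B"
proof (rule mat_col_eqI)
  fix j assume "j < dim_col B"
  then have j: "j < k" using B by simp
  have "col B j = B *\<^sub>v unit_vec k j"
    using col_mult2[OF B one_carrier_mat j] B j by simp
  then have "col B j \<in> vec_space.col_space n A"
    using sub B by (auto simp: col_space_eq_image)
  then obtain x where x: "x \<in> carrier_vec d" "col B j = A *\<^sub>v x"
    using A by (auto simp: col_space_eq_image)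
  have At: "transpose_mat A \<in> carrier_mat d n" using A by simp
  have "col (A * (transpose_mat A * B)) j = A *\<^sub>v (transpose_mat A *\<^sub>v col B j)"
    by (simp only: col_mult2[OF A mult_carrier_mat[OF At B] j] col_mult2[OF At B j])
  also have "\<dots> = A *\<^sub>v ((transpose_mat A * A) *\<^sub>v x)"
    using assoc_mult_mat_vec[OF At A x(1)] x by simp
  also have "\<dots> = col B j"
    using orthonormal x by simp
  finally show "col (A * (transpose_mat A * B)) j = col B j" .
qed (use A B in auto)

text \<open>
  The traces of \<open>T T\<^sup>T\<close> and \<open>T\<^sup>T T\<close> are both the sum of the squared entries of \<open>T\<close>; here they are
  the two dimensions.
\<close>

lemma dim_eq_if_two_sided_transpose_inverse:
  fixes T :: "real mat"
  assumes T: "T \<in> carrier_mat m d"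
    and left: "transpose_mat T * T = 1\<^sub>m d" and right: "T * transpose_mat T = 1\<^sub>m m"
  shows "d = m"
proof -
  have "real m = (\<Sum>i<m. (T * transpose_mat T) $$ (i, i))"
    by (simp add: right)
  also have "\<dots> = (\<Sum>i<m. \<Sum>j<d. T $$ (i, j) * T $$ (i, j))"
    using T by (intro sum.cong) (auto simp: scalar_prod_def atLeast0LessThan)
  also have "\<dots> = (\<Sum>j<d. \<Sum>i<m. T $$ (i, j) * T $$ (i, j))"
    by (rule sum.swap)
  also have "\<dots> = (\<Sum>j<d. (transpose_mat T * T) $$ (j, j))"
    using T by (intro sum.cong) (auto simp: scalar_prod_def atLeast0LessThan)
  also have "\<dots> = real d"
    by (simp add: left)
  finally show ?thesis by simp
qed

lemma arrangement_mat_carrier [simp]: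
  "arrangement_mat n d v \<in> carrier_mat n d"
  by (simp add: arrangement_mat_def mat_of_rows_def del: upt_Suc)

lemma row_arrangement_mat:
  assumes "arrangement n d v" "i < n"
  shows "row (arrangement_mat n d v) i = v (Suc i)"
  using assms by (simp add: arrangement_mat_def arrangement_def del: upt_Suc)

text \<open>
  Vectors are the rows of the arrangement matrix, so applying \<open>T\<close> to every vector multiplies the
  matrix by \<open>T\<^sup>T\<close> from the right.
\<close>

lemma rows_image_iff:
  assumes v: "arrangement n d v" and w: "arrangement n d' w" and T: "T \<in> carrier_mat d' d"
  shows "(\<forall>i\<in>{1..n}. w i = T *\<^sub>v v i) \<longleftrightarrow>
    arrangement_mat n d' w = arrangement_mat n d v * transpose_mat T"
    (is "_ \<longleftrightarrow> ?B = ?A * transpose_mat T")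
proof -
  have A: "?A \<in> carrier_mat n d" and B: "?B \<in> carrier_mat n d'" by simp_all
  have row: "row (?A * transpose_mat T) i = T *\<^sub>v v (Suc i)" if "i < n" for i
  proof (rule eq_vecI)
    fix j assume "j < dim_vec (T *\<^sub>v v (Suc i))"
    then have "j < d'" using T by simp
    moreover have "v (Suc i) \<in> carrier_vec d"
      using v that by (simp add: arrangement_def)
    ultimately show "row (?A * transpose_mat T) i $ j = (T *\<^sub>v v (Suc i)) $ j"
      using that A T row_arrangement_mat[OF v that]
      by (simp add: row_mult[OF A, of "transpose_mat T" d'] comm_scalar_prod[of _ d])
  qed (use A T that in simp)
  have "?B = ?A * transpose_mat T \<longleftrightarrow> (\<forall>i<n. row ?B i = row (?A * transpose_mat T) i)"
    using carrier_matD[OF A] carrier_matD[OF B] carrier_matD[OF T] by (auto intro!: eq_rowI)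
  also have "\<dots> \<longleftrightarrow> (\<forall>i<n. w (Suc i) = T *\<^sub>v v (Suc i))"
    using row row_arrangement_mat[OF w] by simp
  also have "\<dots> \<longleftrightarrow> (\<forall>i\<in>{1..n}. w i = T *\<^sub>v v i)"
    unfolding image_Suc_lessThan[symmetric] by auto
  finally show ?thesis by simp
qed

theorem theorem3p2:
  fixes n d d' :: nat and v w :: "nat \<Rightarrow> real vec"
  assumes "1 \<le> n"
    and "normalized_arrangement n d v"
    and "normalized_arrangement n d' w"
  shows "(equivalent_arrangements n d v d' w \<longleftrightarrow>
            d = d' \<and> (\<exists>T \<in> orthogonal_group d. \<forall>i\<in>{1..n}. w i = T *\<^sub>v v i))
       \<and> (equivalent_arrangements n d v d' w \<longrightarrow>
            (\<forall>T. T \<in> orthogonal_group d \<and> (\<forall>i\<in>{1..n}. w i = T *\<^sub>v v i) \<longleftrightarrow>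
                 T = transpose_mat (arrangement_mat n d' w) * arrangement_mat n d v))"
proof -
  define A where "A = arrangement_mat n d v"
  define B where "B = arrangement_mat n d' w"
  define S where "S = transpose_mat B * A"
  have A: "A \<in> carrier_mat n d" and B: "B \<in> carrier_mat n d'"
    by (simp_all add: A_def B_def)
  then have At: "transpose_mat A \<in> carrier_mat d n" and Bt: "transpose_mat B \<in> carrier_mat d' n"
    and S: "S \<in> carrier_mat d' d" and St: "transpose_mat S = transpose_mat A * B"
    by (auto simp: S_def transpose_mult[of _ d' n _ d])
  have v: "arrangement n d v" and AA: "transpose_mat A * A = 1\<^sub>m d"
    using assms(2) by (simp_all add: normalized_arrangement_def A_def)
  have w: "arrangement n d' w" and BB: "transpose_mat B * B = 1\<^sub>m d'"
    using assms(3) by (simp_all add: normalized_arrangement_def B_def)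
  have equiv: "equivalent_arrangements n d v d' w \<longleftrightarrow>
      vec_space.col_space n A = vec_space.col_space n B"
    by (simp add: equivalent_arrangements_def arrangement_space_def A_def B_def)
  have image: "(\<forall>i\<in>{1..n}. w i = T *\<^sub>v v i) \<longleftrightarrow> B = A * transpose_mat T"
    if "T \<in> carrier_mat d' d" for T
    unfolding A_def B_def by (rule rows_image_iff[OF v w that])

  have necessary: "d = d' \<and> S \<in> orthogonal_group d \<and> B = A * transpose_mat S"
    if "equivalent_arrangements n d v d' w"
  proof -
    have fixB: "A * (transpose_mat A * B) = B"
      by (rule mult_mult_transpose_fixes[OF A B AA]) (use that equiv in simp)
    have fixA: "B * (transpose_mat B * A) = A"
      by (rule mult_mult_transpose_fixes[OF B A BB]) (use that equiv in simp)
    have "transpose_mat S * S = transpose_mat A * (B * S)"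
      using assoc_mult_mat[OF At B S] St by simp
    also have "\<dots> = 1\<^sub>m d" using fixA AA by (simp add: S_def)
    finally have left: "transpose_mat S * S = 1\<^sub>m d" .
    have "S * transpose_mat S = transpose_mat B * (A * transpose_mat S)"
      unfolding S_def by (rule assoc_mult_mat[OF Bt A]) (use S S_def in simp)
    also have "\<dots> = 1\<^sub>m d'" using fixB BB St by simp
    finally have right: "S * transpose_mat S = 1\<^sub>m d'" .
    have "d = d'" by (rule dim_eq_if_two_sided_transpose_inverse[OF S left right])
    then show ?thesis
      using S left fixB St by (simp add: orthogonal_group_def)
  qed

  have sufficient: "equivalent_arrangements n d v d' w"
    if "d = d'" "T \<in> orthogonal_group d" "B = A * transpose_mat T" for T
  proof -
    have T: "T \<in> carrier_mat d d" "transpose_mat T \<in> carrier_mat d d"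
        "transpose_mat T * T = 1\<^sub>m d"
      using that by (simp_all add: orthogonal_group_def)
    have "B * T = A" using assoc_mult_mat[OF A T(2,1)] T(3) that A by simp
    then have "vec_space.col_space n A \<subseteq> vec_space.col_space n B"
      using col_space_mult_subset[OF B, of T d] T that by simp
    moreover have "vec_space.col_space n B \<subseteq> vec_space.col_space n A"
      using col_space_mult_subset[OF A T(2)] that by simp
    ultimately show ?thesis using equiv by simp
  qed

  have unique: "T = S" if T: "T \<in> carrier_mat d' d" and "B = A * transpose_mat T" for T
  proof -
    have Tt: "transpose_mat T \<in> carrier_mat d d'" using T by simp
    have "transpose_mat A * B = transpose_mat T"
      using assoc_mult_mat[OF At A Tt] AA that Tt by simp
    then show ?thesis using St by (metis transpose_transpose)
  qed

  have orth: "T \<in> carrier_mat d d" if "T \<in> orthogonal_group d" for T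
    using that by (simp add: orthogonal_group_def)
  have "equivalent_arrangements n d v d' w \<longleftrightarrow>
      d = d' \<and> (\<exists>T \<in> orthogonal_group d. \<forall>i\<in>{1..n}. w i = T *\<^sub>v v i)"
  proof
    assume eq: "equivalent_arrangements n d v d' w"
    show "d = d' \<and> (\<exists>T \<in> orthogonal_group d. \<forall>i\<in>{1..n}. w i = T *\<^sub>v v i)"
      using necessary[OF eq] image[OF S] by (intro conjI bexI[of _ S]) auto
  next
    assume "d = d' \<and> (\<exists>T \<in> orthogonal_group d. \<forall>i\<in>{1..n}. w i = T *\<^sub>v v i)"
    then obtain T where T: "d = d'" "T \<in> orthogonal_group d" "\<forall>i\<in>{1..n}. w i = T *\<^sub>v v i"
      by (elim conjE bexE)
    then have "B = A * transpose_mat T"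
      using image[of T] orth[of T] by simp
    with T(1,2) show "equivalent_arrangements n d v d' w"
      by (rule sufficient)
  qed
  moreover have "\<forall>T. T \<in> orthogonal_group d \<and> (\<forall>i\<in>{1..n}. w i = T *\<^sub>v v i) \<longleftrightarrow> T = S"
    if "equivalent_arrangements n d v d' w"
  proof (intro allI iffI)
    fix T assume T: "T \<in> orthogonal_group d \<and> (\<forall>i\<in>{1..n}. w i = T *\<^sub>v v i)"
    then have "T \<in> carrier_mat d' d"
      using necessary[OF that] orth[of T] by simp
    moreover from this have "B = A * transpose_mat T"
      using image T by blast
    ultimately show "T = S" by (rule unique)
  next
    fix T assume "T = S"
    then show "T \<in> orthogonal_group d \<and> (\<forall>i\<in>{1..n}. w i = T *\<^sub>v v i)"
      using necessary[OF that] image[OF S] by auto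
  qed
  ultimately show ?thesis
    unfolding S_def A_def B_def by (intro conjI impI)
qed

end
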